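(* Let $\psi\in\Phi$ be such that $\psi(r)\to+\infty$ as $r\to+\infty$. Define $r_0=2$, $r_{k+1}=r_k\psi(r_k)$ for $k\in\mathbb{N}\cup\{0\}$, and $$u_\psi(z)=\frac12\sum_{k=1}^{+\infty}\log\Big|1-\frac{z}{r_k}\Big|,\qquad z\in\mathbb{C}.$$ Then there exists no entire function $f$ for which $$\int_{|z|<R}\big|u_\psi(z)-\log|f(z)|\big|\,dm(z)=o\big(R^2\log\psi(R)\big),\qquad R\to\infty.$$
   Context: $m$ denotes plane Lebesgue measure. $\Phi$ is the class of slowly varying functions $\psi:[1,+\infty)\to(1,+\infty)$, i.e. $\psi(cr)/\psi(r)\to1$ as $r\to+\infty$ for every $c>0$ (in particular $\psi(2r)\sim\psi(r)$). *)

theory Defs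
  imports "HOL-Analysis.Analysis"
begin

definition slowly_varying :: "(real \<Rightarrow> real) \<Rightarrow> bool" where
  "slowly_varying \<psi> \<longleftrightarrow> (\<forall>c>0. ((\<lambda>r. \<psi> (c * r) / \<psi> r) \<longlongrightarrow> 1) at_top)"

(* A map from [1, infinity) to (1, infinity) is a total function constrained on [1, infinity) only;
   its values below 1 are never used in what follows. *)
definition Phi :: "(real \<Rightarrow> real) set" where
  "Phi = {\<psi>. (\<forall>r\<ge>1. \<psi> r > 1) \<and> slowly_varying \<psi>}"

primrec rseq :: "(real \<Rightarrow> real) \<Rightarrow> nat \<Rightarrow> real" where
  "rseq \<psi> 0 = 2"
| "rseq \<psi> (Suc k) = rseq \<psi> k * \<psi> (rseq \<psi> k)"

(* Extended-real valued, so that log|0| = -infinity; the library's ln has the value 0 at 0. *)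
definition log_abs :: "complex \<Rightarrow> ereal" where
  "log_abs w = (if w = 0 then - \<infinity> else ereal (ln (cmod w)))"

(* The sum over k >= 1 is shifted to start at 0.  It is a limit of partial sums in the extended
   reals: the value is -infinity at each point rseq psi k with k >= 1, and a series diverging
   to plus or minus infinity has that infinite value. *)
definition u_psi :: "(real \<Rightarrow> real) \<Rightarrow> complex \<Rightarrow> ereal" where
  "u_psi \<psi> z = ereal (1 / 2) * (\<Sum>k. log_abs (1 - z / of_real (rseq \<psi> (Suc k))))"

end

theory Submission
  imports Defs "HOL-Complex_Analysis.Complex_Analysis"
begin

text \<open>
  Suppose that an entire function \<open>f\<close> has an error integral that is small compared with \<open>R\<^sup>2 ln (\<psi> R)\<close>. The
  contradiction comes from the circle means of \<open>u_psi \<psi> - ln |f|\<close>. As a function of \<open>ln s\<close>, the mean over the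
  circle of radius \<open>s\<close> has slope \<open>k / 2 - n s\<close> for \<open>s\<close> between \<open>rseq \<psi> k\<close> and \<open>rseq \<psi> (Suc k)\<close>, where
  the integer \<open>n s\<close> counts the zeros of \<open>f\<close> of modulus at most \<open>s\<close>; this is Jensen's formula
  (\<open>entire_circle_mean\<close>). For odd \<open>k\<close> the slope is a half-integer, hence at least \<open>1 / 2\<close> in modulus, and it is
  nonincreasing, so it changes sign at most once. Therefore the mean varies by an amount of order \<open>ln (\<psi> r)\<close>
  on the annulus between \<open>r = rseq \<psi> k\<close> and \<open>r * \<psi> r\<close>, whose logarithmic width is \<open>ln (\<psi> r)\<close>
  (\<open>odd_slope_gap\<close>).

  On the other hand, an error integral of size \<open>\<epsilon> R\<^sup>2 ln (\<psi> R)\<close> forces the circle mean to be at most about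
  \<open>\<epsilon> ln (\<psi> R)\<close> at some radius in \<open>(R / 2, R)\<close> (\<open>exists_radius_small_circle_mean\<close>). Slow variation makes
  \<open>ln (\<psi> R)\<close> comparable to \<open>ln (\<psi> r)\<close> throughout the annulus (\<open>doubling_bound\<close>), so three choices of \<open>R\<close>, near the
  ends and near the geometric middle, contradict the variation (\<open>error_integral_not_small\<close>). Bounded terms are
  harmless in all this because \<open>\<psi>\<close> tends to infinity; so the singularities of \<open>u_psi\<close> beyond the annulus enter only through
  a bounded error term (\<open>u_psi_expansion\<close>).

  A separate case arises because \<open>\<psi>\<close> may come close to 1 at bounded arguments: the radii \<open>rseq \<psi> k\<close> can then converge to a
  finite limit. The series for \<open>u_psi\<close> then diverges to \<open>-\<infinity>\<close> on an open set, and the error integral is infinite for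
  every \<open>f\<close> (\<open>u_psi_eq_minus_infinity\<close>, \<open>error_integral_eq_infinity\<close>).
\<close>

section \<open>Rotation invariance of Lebesgue measure\<close>

text \<open>
  Let \<open>E'\<close> be the preimage of \<open>E\<close> under \<open>f\<close> and \<open>B\<close> the unit ball. Evaluating the double integral
  of \<open>1\<^sub>E (f x) 1\<^sub>B (y - f x)\<close> in both orders, with translations by \<open>f x\<close> and by
  preimages of \<open>y\<close>, gives \<open>|E'| |B| = |E| |B|\<close>, because \<open>f\<close> is linear and onto and preserves \<open>B\<close>.
\<close>
lemma distr_lborel_orthogonal_transformation:
  fixes f :: "'a::euclidean_space \<Rightarrow> 'a"
  assumes f: "orthogonal_transformation f"
  shows "distr lborel borel f = lborel"
proof (rule measure_eqI)
  have lin: "linear f" and norm_f: "\<And>x. norm (f x) = norm x"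
    using f by (auto simp: orthogonal_transformation)
  have [measurable]: "f \<in> borel_measurable borel"
    by (intro borel_measurable_continuous_onI linear_continuous_on linear_linear[THEN iffD2] lin)
  show "sets (distr lborel borel f) = sets lborel" by simp
  fix E assume "E \<in> sets (distr lborel borel f)"
  then have [measurable]: "E \<in> sets borel" by simp
  define B :: "'a set" where "B = cball 0 1"
  have [measurable]: "B \<in> sets borel" by (simp add: B_def)
  have translate: "(\<integral>\<^sup>+x. g x \<partial>lborel) = (\<integral>\<^sup>+x. g (c + x) \<partial>lborel)"
    if [measurable]: "g \<in> borel_measurable borel" for g :: "'a \<Rightarrow> ennreal" and c
  proof -
    have "(\<integral>\<^sup>+x. g x \<partial>lborel) = (\<integral>\<^sup>+x. g x \<partial>(distr lborel borel ((+) c)))"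
      by (simp only: lborel_distr_plus)
    also have "\<dots> = (\<integral>\<^sup>+x. g (c + x) \<partial>lborel)" by (rule nn_integral_distr) simp_all
    finally show ?thesis .
  qed
  have symm: "indicator B (- f x) = (indicator B x :: ennreal)" for x
    by (simp add: B_def norm_f indicator_def)
  define E' where "E' = f -` E"
  have [measurable]: "E' \<in> sets borel"
    unfolding E'_def by (metis \<open>f \<in> borel_measurable borel\<close> \<open>E \<in> sets borel\<close> measurable_sets_borel)
  have "emeasure lborel E' * emeasure lborel B
      = (\<integral>\<^sup>+x. \<integral>\<^sup>+y. indicator E (f x) * indicator B y \<partial>lborel \<partial>lborel)"
  proof -
    have "emeasure lborel E' = (\<integral>\<^sup>+x. indicator E (f x) \<partial>lborel)"
      by (subst nn_integral_indicator[symmetric])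
         (simp, auto intro!: nn_integral_cong simp: indicator_def E'_def)
    then show ?thesis by (simp add: nn_integral_cmult nn_integral_multc)
  qed
  also have "\<dots> = (\<integral>\<^sup>+x. \<integral>\<^sup>+y. indicator E (f x) * indicator B (- f x + y) \<partial>lborel \<partial>lborel)"
    by (intro nn_integral_cong translate) measurable
  also have "\<dots> = (\<integral>\<^sup>+y. \<integral>\<^sup>+x. indicator E (f x) * indicator B (- f x + y) \<partial>lborel \<partial>lborel)"
    by (intro lborel_pair.Fubini') measurable
  also have "\<dots> = (\<integral>\<^sup>+y. \<integral>\<^sup>+x. indicator E (f x + y) * indicator B x \<partial>lborel \<partial>lborel)"
  proof (rule nn_integral_cong)
    fix y :: 'a
    obtain c where c: "f c = y"
      using orthogonal_transformation_surj[OF f] by (metis surjD)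
    have "(\<integral>\<^sup>+x. indicator E (f x) * indicator B (- f x + y) \<partial>lborel)
        = (\<integral>\<^sup>+x. indicator E (f (c + x)) * indicator B (- f (c + x) + y) \<partial>lborel)"
      by (intro translate) measurable
    also have "\<dots> = (\<integral>\<^sup>+x. indicator E (f x + y) * indicator B x \<partial>lborel)"
      by (intro nn_integral_cong) (simp add: linear_add[OF lin] c symm add.commute)
    finally show "(\<integral>\<^sup>+x. indicator E (f x) * indicator B (- f x + y) \<partial>lborel)
        = (\<integral>\<^sup>+x. (indicator E (f x + y) * indicator B x :: ennreal) \<partial>lborel)" .
  qed
  also have "\<dots> = (\<integral>\<^sup>+x. \<integral>\<^sup>+y. indicator E (f x + y) * indicator B x \<partial>lborel \<partial>lborel)"
    by (intro lborel_pair.Fubini') measurable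
  also have "\<dots> = (\<integral>\<^sup>+x. \<integral>\<^sup>+y. indicator E y * indicator B x \<partial>lborel \<partial>lborel)"
    by (intro nn_integral_cong translate[symmetric]) measurable
  also have "\<dots> = emeasure lborel E * emeasure lborel B"
    by (simp add: nn_integral_cmult nn_integral_multc)
  finally have *: "emeasure lborel E' * emeasure lborel B = emeasure lborel E * emeasure lborel B" .
  have "emeasure lborel B \<noteq> 0" "emeasure lborel B \<noteq> \<infinity>"
    using unit_ball_vol_pos[of "real DIM('a)"] by (auto simp: B_def emeasure_cball simp del: unit_ball_vol_pos)
  then have "emeasure lborel E' = emeasure lborel E"
    using * by (simp add: mult.commute[of _ "emeasure lborel B"] ennreal_mult_cancel_left)
  then show "emeasure (distr lborel borel f) E = emeasure lborel E"
    by (simp add: emeasure_distr E'_def)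
qed

lemma nn_integral_rotate:
  fixes g :: "complex \<Rightarrow> ennreal"
  assumes [measurable]: "g \<in> borel_measurable borel"
  shows "(\<integral>\<^sup>+z. g (z * cis t) \<partial>lborel) = (\<integral>\<^sup>+z. g z \<partial>lborel)"
proof -
  have "orthogonal_transformation (\<lambda>z. z * cis t)"
    by (auto simp: orthogonal_transformation norm_mult intro!: linearI simp: algebra_simps)
  then have "(\<integral>\<^sup>+z. g z \<partial>lborel) = (\<integral>\<^sup>+z. g z \<partial>(distr lborel borel (\<lambda>z. z * cis t)))"
    by (simp only: distr_lborel_orthogonal_transformation)
  also have "\<dots> = (\<integral>\<^sup>+z. g (z * cis t) \<partial>lborel)"
    by (rule nn_integral_distr) simp_all
  finally show ?thesis ..
qed

section \<open>Area integrals and circle means\<close>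

lemma abs_circle_mean_le:
  fixes G :: "complex \<Rightarrow> real"
  assumes "continuous_on {0..1} (\<lambda>t. G (z * cis (2 * pi * t)))"
    and "((\<lambda>t. G (z * cis (2 * pi * t))) has_integral m) {0..1}"
  shows "ennreal \<bar>m\<bar> \<le> (\<integral>\<^sup>+t\<in>{0..1}. ennreal \<bar>G (z * cis (2 * pi * t))\<bar> \<partial>lborel)"
proof -
  let ?g = "\<lambda>t. G (z * cis (2 * pi * t))"
  have int: "(\<lambda>t. \<bar>?g t\<bar>) integrable_on {0..1}"
    by (intro integrable_continuous_interval continuous_intros assms)
  have "\<bar>m\<bar> \<le> integral {0..1} (\<lambda>t. \<bar>?g t\<bar>)"
    using integral_norm_bound_integral[of ?g "{0..1}" "\<lambda>t. \<bar>?g t\<bar>"] int assms(2)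
    by (auto simp: has_integral_iff)
  then show ?thesis
    using int by (subst nn_integral_has_integral_lebesgue') (auto intro!: ennreal_leI)
qed

text \<open>
  This replaces polar coordinates. The integral of \<open>|G|\<close> over a rotation invariant set does not change
  when \<open>G\<close> is rotated; averaging over all angles and exchanging the integrals turns \<open>|G|\<close> into its
  circle mean, which dominates the modulus of the circle mean of \<open>G\<close>.
\<close>
lemma nn_integral_circle_means_le:
  fixes G :: "complex \<Rightarrow> real" and M :: "real \<Rightarrow> real" and A :: "complex set"
  assumes [measurable]: "G \<in> borel_measurable borel" "M \<in> borel_measurable borel" "A \<in> sets borel"
    and A: "\<And>z t. z * cis t \<in> A \<longleftrightarrow> z \<in> A"
    and M: "AE z in lborel. z \<in> A \<longrightarrow>
        continuous_on {0..1} (\<lambda>t. G (z * cis (2 * pi * t))) \<and>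
        ((\<lambda>t. G (z * cis (2 * pi * t))) has_integral M (cmod z)) {0..1}"
  shows "(\<integral>\<^sup>+z\<in>A. ennreal \<bar>M (cmod z)\<bar> \<partial>lborel) \<le> (\<integral>\<^sup>+z\<in>A. ennreal \<bar>G z\<bar> \<partial>lborel)"
proof -
  have [measurable]: "cis \<in> borel_measurable borel"
    by (intro borel_measurable_continuous_onI continuous_intros)
  have "(\<integral>\<^sup>+z\<in>A. ennreal \<bar>M (cmod z)\<bar> \<partial>lborel)
      \<le> (\<integral>\<^sup>+z. \<integral>\<^sup>+t. ennreal \<bar>G (z * cis (2 * pi * t))\<bar> * indicator A z * indicator {0..1} t \<partial>lborel \<partial>lborel)"
  proof (rule nn_integral_mono_AE, use M in eventually_elim)
    case (elim z)
    show ?case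
      using abs_circle_mean_le[of G z "M (cmod z)"] elim by (cases "z \<in> A") auto
  qed
  also have "\<dots> = (\<integral>\<^sup>+t. \<integral>\<^sup>+z. ennreal \<bar>G (z * cis (2 * pi * t))\<bar> * indicator A z * indicator {0..1} t \<partial>lborel \<partial>lborel)"
    by (intro lborel_pair.Fubini') measurable
  also have "\<dots> = (\<integral>\<^sup>+t. (\<integral>\<^sup>+z\<in>A. ennreal \<bar>G z\<bar> \<partial>lborel) * indicator {0..1::real} t \<partial>lborel)"
  proof (rule nn_integral_cong)
    fix t :: real
    have "(\<integral>\<^sup>+z. ennreal \<bar>G (z * cis (2 * pi * t))\<bar> * indicator A z * indicator {0..1} t \<partial>lborel)
        = (\<integral>\<^sup>+z. ennreal \<bar>G (z * cis (2 * pi * t))\<bar> * indicator A (z * cis (2 * pi * t)) \<partial>lborel) * indicator {0..1} t"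
      by (simp add: nn_integral_multc A indicator_def[of A])
    also have "\<dots> = (\<integral>\<^sup>+z\<in>A. ennreal \<bar>G z\<bar> \<partial>lborel) * indicator {0..1} t"
      by (subst nn_integral_rotate[of "\<lambda>z. ennreal \<bar>G z\<bar> * indicator A z"]) simp_all
    finally show "(\<integral>\<^sup>+z. ennreal \<bar>G (z * cis (2 * pi * t))\<bar> * indicator A z * indicator {0..1} t \<partial>lborel)
        = (\<integral>\<^sup>+z\<in>A. ennreal \<bar>G z\<bar> \<partial>lborel) * indicator {0..1} t" .
  qed
  also have "\<dots> = (\<integral>\<^sup>+z\<in>A. ennreal \<bar>G z\<bar> \<partial>lborel)"
    by (simp add: nn_integral_cmult)
  finally show ?thesis .
qed

lemma emeasure_half_annulus:
  assumes "0 < R"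
  shows "emeasure lborel {z. R / 2 < cmod z \<and> cmod z < R} = ennreal (3 / 4 * pi * R\<^sup>2)"
proof -
  have "{z. R / 2 < cmod z \<and> cmod z < R} = ball 0 R - cball 0 (R / 2)" by auto
  also have "emeasure lborel \<dots> = emeasure lborel (ball 0 R :: complex set) - emeasure lborel (cball 0 (R / 2) :: complex set)"
    using assms by (intro emeasure_Diff) (auto simp: emeasure_cball)
  also have "\<dots> = ennreal (3 / 4 * pi * R\<^sup>2)"
    using assms by (simp add: emeasure_ball emeasure_cball unit_ball_vol_2 ennreal_minus power_divide)
  finally show ?thesis .
qed

text \<open>
  The way from an area integral to a single radius: the annulus has area at least \<open>R\<^sup>2\<close>, so the circle
  means cannot all exceed \<open>K\<close> in modulus.
\<close>
lemma exists_radius_small_circle_mean: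
  fixes G :: "complex \<Rightarrow> real" and M :: "real \<Rightarrow> real"
  assumes [measurable]: "G \<in> borel_measurable borel" "M \<in> borel_measurable borel"
    and M: "AE z in lborel. R / 2 < cmod z \<and> cmod z < R \<longrightarrow>
        continuous_on {0..1} (\<lambda>t. G (z * cis (2 * pi * t))) \<and>
        ((\<lambda>t. G (z * cis (2 * pi * t))) has_integral M (cmod z)) {0..1}"
    and "0 < R" "0 \<le> K"
    and G: "(\<integral>\<^sup>+z\<in>{z. R / 2 < cmod z \<and> cmod z < R}. ennreal \<bar>G z\<bar> \<partial>lborel) < ennreal (K * R\<^sup>2)"
  shows "\<exists>s. R / 2 < s \<and> s < R \<and> \<bar>M s\<bar> \<le> K"
proof (rule ccontr)
  assume "\<not> ?thesis"
  then have large: "K \<le> \<bar>M s\<bar>" if "R / 2 < s" "s < R" for s using that by force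
  define A where "A = {z. R / 2 < cmod z \<and> cmod z < R}"
  have [measurable]: "A \<in> sets borel" unfolding A_def by measurable
  \<comment> \<open>The area \<open>3 / 4 * pi * R\<^sup>2\<close> of the annulus exceeds \<open>R\<^sup>2\<close>.\<close>
  have "K * R\<^sup>2 * 1 \<le> K * R\<^sup>2 * (3 / 4 * pi)"
    using \<open>0 \<le> K\<close> pi_gt3 by (intro mult_left_mono) auto
  then have "ennreal (K * R\<^sup>2) \<le> ennreal (K * (3 / 4 * pi * R\<^sup>2))"
    by (intro ennreal_leI) (simp add: mult_ac)
  also have "\<dots> = (\<integral>\<^sup>+z\<in>A. ennreal K \<partial>lborel)"
    using emeasure_half_annulus[OF \<open>0 < R\<close>, folded A_def] \<open>0 \<le> K\<close>
    by (simp only: nn_integral_cmult_indicator \<open>A \<in> sets borel\<close> sets_lborel ennreal_mult')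
  also have "\<dots> \<le> (\<integral>\<^sup>+z\<in>A. ennreal \<bar>M (cmod z)\<bar> \<partial>lborel)"
    using large by (intro nn_integral_mono) (auto simp: A_def indicator_def intro!: ennreal_leI)
  also have "\<dots> \<le> (\<integral>\<^sup>+z\<in>A. ennreal \<bar>G z\<bar> \<partial>lborel)"
    using M by (intro nn_integral_circle_means_le) (auto simp: A_def norm_mult)
  finally show False using G by (simp add: A_def not_less)
qed

text \<open>
  Exceptional radii, on which a zero lies, may be ignored in area integrals.
\<close>
lemma AE_cmod_notin_finite:
  assumes "finite X"
  shows "AE z in lborel. cmod z \<notin> X"
proof -
  have "AE z in lborel. cmod z \<noteq> x" for x
  proof -
    have "sphere 0 x \<in> null_sets (lborel :: complex measure)"
      using negligible_sphere[of "0 :: complex" x] by (simp add: negligible_iff_null_sets null_sets_completion_iff)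
    from AE_not_in[OF this] show ?thesis by simp
  qed
  then have "AE z in lborel. \<forall>x\<in>X. cmod z \<noteq> x"
    using assms by (subst AE_finite_all) auto
  then show ?thesis by eventually_elim auto
qed

section \<open>Circle means of the logarithm of the modulus\<close>

text \<open>
  Cauchy's formula at the centre of the unit circle, for \<open>w \<mapsto> h (z * w)\<close>. Starting the circle at
  \<open>z\<close> instead of \<open>cmod z\<close> is what the averaging over rotations requires.
\<close>
lemma holomorphic_circle_mean:
  assumes "h holomorphic_on cball 0 (cmod z)"
  shows "((\<lambda>t. h (z * cis (2 * pi * t))) has_integral h 0) {0..1}"
proof -
  have "(\<lambda>w. h (z * w)) holomorphic_on cball 0 1"
    by (rule holomorphic_on_compose_gen[OF _ assms, unfolded o_def])
       (auto intro!: holomorphic_intros simp: norm_mult mult_left_le)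
  from Cauchy_integral_circlepath_simple[OF this, of 0]
  have "((\<lambda>w. h (z * w) / w) has_contour_integral 2 * pi * \<i> * h 0) (circlepath 0 1)"
    by simp
  then have "((\<lambda>t. 2 * pi * \<i> * h (z * cis (2 * pi * t))) has_integral 2 * pi * \<i> * h 0) {0..1}"
    unfolding has_contour_integral
  proof (rule has_integral_eq[rotated])
    fix t :: real assume "t \<in> {0..1}"
    then have "vector_derivative (circlepath 0 1) (at t) = 2 * pi * \<i> * exp (2 * pi * \<i> * t)"
      by (subst vector_derivative_circlepath) auto
    then show "h (z * circlepath 0 1 t) / circlepath 0 1 t * vector_derivative (circlepath 0 1) (at t)
        = 2 * pi * \<i> * h (z * cis (2 * pi * t))"
      by (simp only:) (simp add: circlepath cis_conv_exp mult_ac)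
  qed
  from has_integral_mult_right[OF this, of "1 / (2 * pi * \<i>)"] show ?thesis
    by simp
qed

lemma Re_holomorphic_circle_mean:
  assumes "h holomorphic_on cball 0 (cmod z)"
  shows "((\<lambda>t. Re (h (z * cis (2 * pi * t)))) has_integral Re (h 0)) {0..1}"
  using has_integral_linear[OF holomorphic_circle_mean[OF assms] bounded_linear_Re] by (simp add: o_def)

text \<open>
  For \<open>cmod z < cmod a\<close> this is the mean value property of \<open>ln |w - a|\<close>. The other case reduces to it, because
  \<open>|z u - a| = |cnj a u - cnj z|\<close> for \<open>|u| = 1\<close> exchanges the roles of \<open>a\<close> and \<open>z\<close>.
\<close>
lemma ln_cmod_diff_circle_mean:
  assumes "cmod a \<noteq> cmod z"
  shows "((\<lambda>t. ln (cmod (z * cis (2 * pi * t) - a))) has_integral ln (max (cmod z) (cmod a))) {0..1}"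
proof -
  have *: "((\<lambda>t. ln (cmod (z * cis (2 * pi * t) - a))) has_integral ln (cmod a)) {0..1}"
    if "cmod z < cmod a" for z a
  proof -
    have a: "a \<noteq> 0" using that by auto
    have re: "w / a \<noteq> 1 \<and> 0 < Re (1 - w / a)" if "cmod w \<le> cmod z" for w
    proof -
      have "cmod (w / a) < 1" using that \<open>cmod z < cmod a\<close> a by (simp add: norm_divide)
      then show ?thesis using complex_Re_le_cmod[of "w / a"] by auto
    qed
    have "(\<lambda>w. Ln (1 - w / a)) holomorphic_on cball 0 (cmod z)"
      by (intro holomorphic_intros) (use re a in \<open>auto simp: complex_nonpos_Reals_iff\<close>, force)
    from Re_holomorphic_circle_mean[OF this]
    have "((\<lambda>t. Re (Ln (1 - z * cis (2 * pi * t) / a))) has_integral 0) {0..1}" by simp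
    from has_integral_add[OF has_integral_const_real[of "ln (cmod a)" 0 1] this]
    have "((\<lambda>t. ln (cmod a) + Re (Ln (1 - z * cis (2 * pi * t) / a))) has_integral ln (cmod a)) {0..1}"
      by simp
    then show ?thesis
    proof (rule has_integral_eq[rotated])
      fix t :: real
      let ?w = "z * cis (2 * pi * t)"
      have ne: "1 - ?w / a \<noteq> 0" using re[of ?w] by (auto simp: norm_mult)
      have "cmod (?w - a) = cmod a * cmod (1 - ?w / a)"
        using a by (simp add: norm_mult[symmetric] norm_minus_commute right_diff_distrib)
      then show "ln (cmod a) + Re (Ln (1 - ?w / a)) = ln (cmod (?w - a))"
        using ne a by (simp add: ln_mult)
    qed
  qed
  show ?thesis
  proof (cases "cmod z < cmod a")
    case True
    then show ?thesis using *[of z a] by (simp add: max_def)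
  next
    case False
    then have lt: "cmod (cnj a) < cmod (cnj z)" using assms by simp
    have "cmod (z * cis t - a) = cmod (cnj a * cis t - cnj z)" for t
    proof -
      have "cmod (z * cis t - a) = cmod (cnj (z * cis t - a) * cis t)" by (simp add: norm_mult del: complex_cnj_diff)
      also have "cnj (z * cis t - a) * cis t = cnj z - cnj a * cis t"
        by (simp add: algebra_simps cis_cnj cis_mult)
      finally show ?thesis by (simp add: norm_minus_commute)
    qed
    then show ?thesis using *[OF lt] False by (simp add: max_def)
  qed
qed

lemma ln_cmod_prod_circle_mean:
  assumes "\<And>a. a \<in> set xs \<Longrightarrow> cmod a \<noteq> cmod z"
  shows "((\<lambda>t. ln (cmod (\<Prod>a\<leftarrow>xs. z * cis (2 * pi * t) - a)))
      has_integral (\<Sum>a\<leftarrow>xs. ln (max (cmod z) (cmod a)))) {0..1}"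
  using assms
proof (induction xs)
  case (Cons a xs)
  have ne: "z * cis t - b \<noteq> 0" if "b \<in> set (a # xs)" for t b
    using Cons.prems[OF that] by (auto simp: norm_mult)
  then have "(\<Prod>a\<leftarrow>xs. z * cis t - a) \<noteq> 0" for t
    by (auto simp: prod_list_zero_iff)
  with ne have "ln (cmod (\<Prod>a\<leftarrow>a # xs. z * cis t - a))
      = ln (cmod (z * cis t - a)) + ln (cmod (\<Prod>a\<leftarrow>xs. z * cis t - a))" for t
    by (simp add: norm_mult ln_mult)
  then show ?case
    using has_integral_add[OF ln_cmod_diff_circle_mean[of a z] Cons.IH] Cons.prems by simp
qed auto

text \<open>
  The list \<open>xs\<close> enumerates the zeros with multiplicity. One zero \<open>a\<close> is split off at a time: the quotient
  \<open>f w / (w - a) ^ n\<close> extends holomorphically over \<open>a\<close> by the local factorization there.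
\<close>
lemma holomorphic_eq_prod_zeros_mult_nonzero:
  assumes "f holomorphic_on S" "open S" "connected S" "finite {z \<in> S. f z = 0}"
  shows "\<exists>xs g. g holomorphic_on S \<and> (\<forall>z\<in>S. g z \<noteq> 0 \<and> f z = (\<Prod>a\<leftarrow>xs. z - a) * g z)"
  using assms
proof (induction "card {z \<in> S. f z = 0}" arbitrary: f rule: less_induct)
  case less
  show ?case
  proof (cases "{z \<in> S. f z = 0} = {}")
    case True
    then show ?thesis using less.prems by (intro exI[of _ "[]"] exI[of _ f]) auto
  next
    case False
    then obtain a where a: "a \<in> S" "f a = 0" by auto
    have "\<not> f constant_on S"
    proof
      assume "f constant_on S"
      then have "{z \<in> S. f z = 0} = S" using a by (auto simp: constant_on_def)
      then show False using less.prems a finite_imp_not_open[of S] by auto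
    qed
    then obtain g r n where g: "0 < n" "0 < r" "ball a r \<subseteq> S" "g holomorphic_on ball a r"
        "\<And>w. w \<in> ball a r \<Longrightarrow> f w = (w - a) ^ n * g w" "\<And>w. w \<in> ball a r \<Longrightarrow> g w \<noteq> 0"
      using holomorphic_factor_zero_nonconstant[OF less.prems(1-3) a] by metis
    define h where "h w = (if w \<in> ball a r then g w else f w / (w - a) ^ n)" for w
    have "h holomorphic_on ball a r \<union> (S - {a})"
      unfolding h_def using less.prems g
      by (intro holomorphic_on_If_Un) (auto intro!: holomorphic_intros intro: holomorphic_on_subset open_delete)
    then have h: "h holomorphic_on S" by (rule holomorphic_on_subset) (use g(2) in auto)
    have fh: "f z = (z - a) ^ n * h z" for z
      using g by (cases "z = a") (auto simp: h_def a)
    have ha: "h a \<noteq> 0" using g(2) g(6)[of a] by (simp add: h_def)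
    have "{z \<in> S. h z = 0} \<subset> {z \<in> S. f z = 0}" using a ha by (auto simp: fh)
    with less.prems have "card {z \<in> S. h z = 0} < card {z \<in> S. f z = 0}" "finite {z \<in> S. h z = 0}"
      by (auto intro: psubset_card_mono finite_subset)
    from less.hyps[OF this(1) h less.prems(2,3) this(2)] obtain xs k where
      k: "k holomorphic_on S" "\<forall>z\<in>S. k z \<noteq> 0 \<and> h z = (\<Prod>a\<leftarrow>xs. z - a) * k z" by blast
    then show ?thesis
      by (intro exI[of _ "replicate n a @ xs"] exI[of _ k]) (auto simp: fh)
  qed
qed

text \<open>
  Jensen's formula. On the disc of radius \<open>\<rho>\<close>, which is simply connected, the zero-free factor of \<open>f\<close> is
  \<open>exp h\<close>, and \<open>Re h\<close> contributes the same constant \<open>C = Re (h 0)\<close> to the mean over every circle. The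
  formula is stated with \<open>C\<close> unspecified, so that a zero at the origin needs no separate treatment.
\<close>
lemma entire_circle_mean:
  assumes "f holomorphic_on UNIV" "f z0 \<noteq> 0"
  obtains xs C where
    "\<And>z. cmod z < \<rho> \<Longrightarrow> (\<And>a. a \<in> set xs \<Longrightarrow> cmod a \<noteq> cmod z) \<Longrightarrow> f z \<noteq> 0"
    "\<And>z. cmod z < \<rho> \<Longrightarrow> (\<And>a. a \<in> set xs \<Longrightarrow> cmod a \<noteq> cmod z) \<Longrightarrow>
       ((\<lambda>t. ln (cmod (f (z * cis (2 * pi * t))))) has_integral
         C + (\<Sum>a\<leftarrow>xs. ln (max (cmod z) (cmod a)))) {0..1}"
proof -
  have "finite {z \<in> cball 0 \<rho>. f z = 0}"
  proof (cases "f constant_on UNIV")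
    case True
    with assms have "f z \<noteq> 0" for z by (auto simp: constant_on_def)
    then show ?thesis by simp
  next
    case False
    with assms show ?thesis by (intro holomorphic_compact_finite_zeros[of f UNIV]) auto
  qed
  then have "finite {z \<in> ball 0 \<rho>. f z = 0}" by (rule finite_subset[rotated]) auto
  moreover have "f holomorphic_on ball 0 \<rho>" using assms(1) by (rule holomorphic_on_subset) simp
  ultimately obtain xs g where g: "g holomorphic_on ball 0 \<rho>"
      "\<And>z. z \<in> ball 0 \<rho> \<Longrightarrow> g z \<noteq> 0"
      "\<And>z. z \<in> ball 0 \<rho> \<Longrightarrow> f z = (\<Prod>a\<leftarrow>xs. z - a) * g z"
    using holomorphic_eq_prod_zeros_mult_nonzero[of f "ball 0 \<rho>"] by auto
  obtain h where h: "h holomorphic_on ball 0 \<rho>" "\<And>z. z \<in> ball 0 \<rho> \<Longrightarrow> g z = exp (h z)"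
    by (rule contractible_imp_holomorphic_log[OF g(1)])
       (auto intro: convex_imp_contractible simp: g(2)[simplified])
  have nz: "(\<Prod>a\<leftarrow>xs. z - a) \<noteq> 0" if "\<And>a. a \<in> set xs \<Longrightarrow> cmod a \<noteq> cmod z" for z
    using that by (force simp: prod_list_zero_iff)
  show ?thesis
  proof (rule that[of xs "Re (h 0)"])
    fix z assume z: "cmod z < \<rho>" "\<And>a. a \<in> set xs \<Longrightarrow> cmod a \<noteq> cmod z"
    show "f z \<noteq> 0" using z nz[of z] g(2,3)[of z] by simp
    have "ln (cmod (f (z * cis t))) = Re (h (z * cis t)) + ln (cmod (\<Prod>a\<leftarrow>xs. z * cis t - a))" for t
      using z nz[of "z * cis t"] g(3)[of "z * cis t"] h(2)[of "z * cis t"]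
      by (simp add: norm_mult ln_mult)
    moreover have "h holomorphic_on cball 0 (cmod z)"
      using h(1) by (rule holomorphic_on_subset) (use z in auto)
    ultimately show "((\<lambda>t. ln (cmod (f (z * cis (2 * pi * t))))) has_integral
        Re (h 0) + (\<Sum>a\<leftarrow>xs. ln (max (cmod z) (cmod a)))) {0..1}"
      using has_integral_add[OF Re_holomorphic_circle_mean ln_cmod_prod_circle_mean[OF z(2)]] by simp
  qed
qed

section \<open>Half-integral slopes against integral slopes\<close>

text \<open>
  As a function of \<open>ln s\<close>, the sum has slope equal to the number of entries of modulus at most \<open>s\<close>, which
  is nondecreasing in \<open>s\<close>. This lemma and the next are the resulting convexity estimates.
\<close>
lemma sum_ln_max_diff_le:
  assumes "0 < s" "s \<le> s'"
  shows "(\<Sum>a\<leftarrow>xs. ln (max s' (cmod a))) - (\<Sum>a\<leftarrow>xs. ln (max s (cmod a)))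
      \<le> length (filter (\<lambda>a. cmod a \<le> s') xs) * (ln s' - ln s)"
proof (induction xs)
  case (Cons a xs)
  have "ln (max s' (cmod a)) - ln (max s (cmod a)) \<le> (if cmod a \<le> s' then ln s' - ln s else 0)"
    using assms by (auto simp: max_def intro!: ln_mono)
  with Cons show ?case by (auto simp: algebra_simps split: if_splits)
qed simp

lemma sum_ln_max_diff_ge:
  assumes "0 < s" "s \<le> s'"
  shows "length (filter (\<lambda>a. cmod a \<le> s) xs) * (ln s' - ln s)
      \<le> (\<Sum>a\<leftarrow>xs. ln (max s' (cmod a))) - (\<Sum>a\<leftarrow>xs. ln (max s (cmod a)))"
proof (induction xs)
  case (Cons a xs)
  have "(if cmod a \<le> s then ln s' - ln s else 0) \<le> ln (max s' (cmod a)) - ln (max s (cmod a))"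
    using assms by (auto simp: max_def intro!: ln_mono)
  with Cons show ?case by (auto simp: algebra_simps split: if_splits)
qed simp

text \<open>
  The parity argument. In the variable \<open>ln s\<close>, the function \<open>D\<close> is concave with slopes in \<open>k / 2 - \<nat>\<close>, none of
  which is closer to 0 than \<open>1 / 2\<close> as \<open>k\<close> is odd. If the slope is still positive at \<open>s2\<close>, then \<open>D\<close> grows at rate at
  least \<open>1 / 2\<close> from \<open>s1\<close> to \<open>s2\<close>; otherwise it decays at that rate from \<open>s2\<close> to \<open>s3\<close>. As \<open>|D|\<close>
  is at most \<open>K\<close> at all three points, one of the two intervals is short.
\<close>
lemma odd_slope_gap:
  fixes xs :: "complex list" and k :: nat and C K :: real
  defines "D \<equiv> \<lambda>s. real k / 2 * ln s - (\<Sum>a\<leftarrow>xs. ln (max s (cmod a))) + C"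
  assumes "odd k" "0 < s1" "s1 \<le> s2" "s2 \<le> s3"
    and D: "\<bar>D s1\<bar> \<le> K" "\<bar>D s2\<bar> \<le> K" "\<bar>D s3\<bar> \<le> K"
  shows "ln s2 - ln s1 \<le> 4 * K \<or> ln s3 - ln s2 \<le> 4 * K"
proof -
  define n where "n = length (filter (\<lambda>a. cmod a \<le> s2) xs)"
  have D_diff: "D s' - D s = real k / 2 * (ln s' - ln s)
      - ((\<Sum>a\<leftarrow>xs. ln (max s' (cmod a))) - (\<Sum>a\<leftarrow>xs. ln (max s (cmod a))))" for s s'
    by (simp add: D_def right_diff_distrib)
  show ?thesis
  proof (cases "2 * n \<le> k")
    case True
    with \<open>odd k\<close> have "1/2 \<le> real k / 2 - n" by (auto elim!: oddE)
    then have "1/2 * (ln s2 - ln s1) \<le> (real k / 2 - n) * (ln s2 - ln s1)"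
      using assms by (intro mult_right_mono) auto
    also have "\<dots> \<le> D s2 - D s1"
      using sum_ln_max_diff_le[of s1 s2 xs] assms(3,4) unfolding D_diff n_def left_diff_distrib by linarith
    finally show ?thesis using D by (auto simp: abs_le_iff)
  next
    case False
    with \<open>odd k\<close> have "1/2 \<le> n - real k / 2" by (auto elim!: oddE)
    then have "1/2 * (ln s3 - ln s2) \<le> (n - real k / 2) * (ln s3 - ln s2)"
      using assms by (intro mult_right_mono) auto
    also have "\<dots> \<le> - (D s3 - D s2)"
      using sum_ln_max_diff_ge[of s2 s3 xs] assms(3-5) unfolding D_diff n_def left_diff_distrib by linarith
    finally show ?thesis using D by (auto simp: abs_le_iff)
  qed
qed

section \<open>The radii and the potential\<close>

lemma rseq_ge_2:
  assumes "\<psi> \<in> Phi"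
  shows "2 \<le> rseq \<psi> k"
proof (induction k)
  case (Suc k)
  have "rseq \<psi> k * 1 \<le> rseq \<psi> k * \<psi> (rseq \<psi> k)"
    using assms Suc by (intro mult_left_mono) (auto simp: Phi_def intro!: less_imp_le)
  with Suc have "2 \<le> rseq \<psi> k * \<psi> (rseq \<psi> k)" by linarith
  then show ?case by simp
qed simp

lemma incseq_rseq:
  assumes "\<psi> \<in> Phi"
  shows "incseq (rseq \<psi>)"
proof (rule incseq_SucI)
  fix k
  have "rseq \<psi> k * 1 \<le> rseq \<psi> k * \<psi> (rseq \<psi> k)"
    using assms rseq_ge_2[OF assms, of k] by (intro mult_left_mono) (auto simp: Phi_def intro!: less_imp_le)
  then show "rseq \<psi> k \<le> rseq \<psi> (Suc k)" by simp
qed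

lemma ln_cmod_one_minus_le:
  assumes "cmod w < 1 / 2"
  shows "\<bar>ln (cmod (1 - w))\<bar> \<le> 2 * cmod w"
proof -
  have "w \<noteq> 1" using assms by auto
  then have "\<bar>ln (cmod (1 - w))\<bar> = \<bar>Re (Ln (1 - w))\<bar>" by simp
  also have "\<dots> \<le> 2 * cmod w"
    using norm_Ln_le[of "- w"] abs_Re_le_cmod[of "Ln (1 - w)"] assms by simp
  finally show ?thesis .
qed

text \<open>
  Well inside the circle of radius \<open>r (Suc k)\<close>, the factors from that radius on contribute only a
  bounded term, because the radii grow at least geometrically.
\<close>
lemma u_psi_expansion:
  fixes \<psi> :: "real \<Rightarrow> real"
  defines "r \<equiv> rseq \<psi>"
  assumes r_pos: "\<And>j. 0 < r j" and double: "\<And>j. k < j \<Longrightarrow> 2 * r j \<le> r (Suc j)"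
    and z: "2 * cmod z < r (Suc k)" "\<And>j. j < k \<Longrightarrow> z \<noteq> of_real (r (Suc j))"
  shows "\<exists>T. \<bar>T\<bar> \<le> 1 \<and>
    u_psi \<psi> z = ereal (1 / 2 * (\<Sum>j<k. ln (cmod (1 - z / of_real (r (Suc j))))) + T)"
proof -
  define t where "t j = ln (cmod (1 - z / of_real (r (Suc j))))" for j
  have grow: "2 ^ i * r (Suc k) \<le> r (Suc (i + k))" for i
  proof (induction i)
    case (Suc i)
    then show ?case using double[of "Suc (i + k)"] by simp
  qed simp
  have small: "cmod (z / of_real (r (Suc (i + k)))) < 1 / 2 * (1 / 2) ^ i" for i
  proof -
    have "2 * cmod z * 2 ^ i < r (Suc k) * 2 ^ i" using z by simp
    also have "\<dots> \<le> r (Suc (i + k))" using grow[of i] by (simp add: mult.commute)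
    finally show ?thesis using r_pos[of "Suc (i + k)"]
      by (simp add: norm_divide field_simps power_one_over)
  qed
  have small': "cmod (z / of_real (r (Suc (i + k)))) < 1 / 2" for i
    using small[of i] power_le_one[of "1 / 2 :: real" i] by linarith
  have t_le: "\<bar>t (i + k)\<bar> \<le> (1 / 2) ^ i" for i
    using ln_cmod_one_minus_le[OF small'[of i]] small[of i] unfolding t_def by linarith
  have geo: "summable (\<lambda>i. (1 / 2 :: real) ^ i)" "(\<Sum>i. (1 / 2 :: real) ^ i) = 2"
    by (simp_all add: summable_geometric suminf_geometric)
  have sm: "summable (\<lambda>i. \<bar>t (i + k)\<bar>)"
    by (rule summable_comparison_test'[OF geo(1), of 0]) (use t_le in auto)
  then have "summable (\<lambda>i. t (i + k))" by (rule summable_rabs_cancel)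
  then have "summable t" by (simp only: summable_iff_shift)
  define T where "T = 1 / 2 * (\<Sum>i. t (i + k))"
  have "\<bar>\<Sum>i. t (i + k)\<bar> \<le> (\<Sum>i. \<bar>t (i + k)\<bar>)" by (rule summable_rabs[OF sm])
  also have "\<dots> \<le> (\<Sum>i. (1 / 2) ^ i)" by (rule suminf_le[OF t_le sm geo(1)])
  finally have "\<bar>T\<bar> \<le> 1" by (simp add: T_def geo)
  have nz: "1 - z / of_real (r (Suc j)) \<noteq> 0" for j
  proof (cases "j < k")
    case True
    then show ?thesis using z(2)[OF True] r_pos[of "Suc j"] by (auto simp: field_simps)
  next
    case False
    then show ?thesis using small'[of "j - k"] by auto
  qed
  have "(\<lambda>j. log_abs (1 - z / of_real (r (Suc j)))) = (\<lambda>j. ereal (t j))"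
    using nz by (auto simp: log_abs_def t_def)
  moreover have "(\<lambda>j. ereal (t j)) sums ereal (\<Sum>j. t j)"
    using \<open>summable t\<close> by (simp only: sums_ereal summable_sums)
  ultimately have "u_psi \<psi> z = ereal (1 / 2 * (\<Sum>j. t j))"
    unfolding u_psi_def r_def[symmetric] by (simp add: sums_unique[symmetric])
  also have "(\<Sum>j. t j) = (\<Sum>i. t (i + k)) + (\<Sum>j<k. t j)"
    by (rule suminf_split_initial_segment[OF \<open>summable t\<close>])
  finally show ?thesis
    using \<open>\<bar>T\<bar> \<le> 1\<close> by (intro exI[of _ T]) (simp add: T_def t_def algebra_simps)
qed

text \<open>
  If the radii accumulate at a finite point \<open>L\<close>, the terms of the series tend to \<open>ln |1 - z / L| < 0\<close> and the
  partial sums diverge. Taking \<open>z\<close> off the real axis keeps every single term finite.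
\<close>
lemma u_psi_eq_minus_infinity:
  assumes lim: "rseq \<psi> \<longlonglongrightarrow> L" and z: "Im z \<noteq> 0" "cmod (1 - z / of_real L) < 1" and "0 < L"
  shows "u_psi \<psi> z = - \<infinity>"
proof -
  define t where "t j = ln (cmod (1 - z / of_real (rseq \<psi> (Suc j))))" for j
  have nz: "1 - z / of_real x \<noteq> 0" for x :: real
  proof
    assume "1 - z / of_real x = 0"
    then have "z = of_real x" by (auto simp: field_simps split: if_splits)
    with z(1) show False by simp
  qed
  have "t \<longlonglongrightarrow> ln (cmod (1 - z / of_real L))"
    unfolding t_def by (intro tendsto_intros lim[THEN LIMSEQ_Suc]) (use z(1) nz[of L] \<open>0 < L\<close> in auto)
  moreover have "ln (cmod (1 - z / of_real L)) < 0" using z nz by (simp add: ln_less_zero_iff)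
  ultimately obtain c where c: "c < 0" "\<forall>\<^sub>F j in sequentially. t j < c"
    by (metis dense order_tendstoD(2))
  then obtain N where N: "\<And>j. N \<le> j \<Longrightarrow> t j < c" by (auto simp: eventually_sequentially)
  have le: "(\<Sum>j<n. t j) \<le> (\<Sum>j<N. t j) + (real n - real N) * c" if "N \<le> n" for n
    using that
  proof (induction n rule: dec_induct)
    case (step n)
    then show ?case using N[of n] by (simp add: algebra_simps)
  qed simp
  have "filterlim (\<lambda>n. (\<Sum>j<N. t j) + (real n - real N) * c) at_bot sequentially"
    unfolding filterlim_at_bot
  proof
    fix Z
    have "\<forall>\<^sub>F n in sequentially. real N + (Z - (\<Sum>j<N. t j)) / c \<le> real n"
      using filterlim_real_sequentially by (simp add: filterlim_at_top)
    then show "\<forall>\<^sub>F n in sequentially. (\<Sum>j<N. t j) + (real n - real N) * c \<le> Z"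
    proof eventually_elim
      case (elim n)
      then have "(Z - (\<Sum>j<N. t j)) / c \<le> real n - real N" by simp
      then show ?case using \<open>c < 0\<close> by (simp add: neg_divide_le_eq)
    qed
  qed
  then have "filterlim (\<lambda>n. \<Sum>j<n. t j) at_bot sequentially"
    by (rule filterlim_at_bot_mono) (use le in \<open>auto simp: eventually_sequentially\<close>)
  then have "(\<lambda>j. ereal (t j)) sums (- \<infinity>)"
    unfolding sums_def tendsto_MInfty by (auto simp: filterlim_at_bot_dense)
  moreover have "(\<lambda>j. log_abs (1 - z / of_real (rseq \<psi> (Suc j)))) = (\<lambda>j. ereal (t j))"
    unfolding log_abs_def t_def by (simp only: nz if_False)
  ultimately show ?thesis unfolding u_psi_def by (simp add: sums_unique[symmetric])
qed

section \<open>Lower bounds for the error integral\<close>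

abbreviation error_integral :: "(real \<Rightarrow> real) \<Rightarrow> (complex \<Rightarrow> complex) \<Rightarrow> real \<Rightarrow> ennreal" where
  "error_integral \<psi> f R \<equiv> (\<integral>\<^sup>+ z \<in> {z. cmod z < R}. e2ennreal \<bar>u_psi \<psi> z - log_abs (f z)\<bar> \<partial>lborel)"

lemma error_integral_eq_infinity:
  assumes "0 < e" "cmod c + e \<le> R"
    and inf: "\<And>z. z \<in> ball c e \<Longrightarrow> \<bar>u_psi \<psi> z - log_abs (f z)\<bar> = \<infinity>"
  shows "error_integral \<psi> f R = \<infinity>"
proof -
  have less: "cmod z < R" if "z \<in> ball c e" for z
    using assms(2) that norm_triangle_ineq[of c "z - c"] by (simp add: dist_norm norm_minus_commute)
  have "(\<integral>\<^sup>+z. \<infinity> * indicator (ball c e) z \<partial>lborel) \<le> error_integral \<psi> f R"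
  proof (rule nn_integral_mono)
    fix z
    show "\<infinity> * indicator (ball c e) z
        \<le> e2ennreal \<bar>u_psi \<psi> z - log_abs (f z)\<bar> * indicator {z. cmod z < R} z"
    proof (cases "z \<in> ball c e")
      case True
      then show ?thesis using inf[OF True] less[OF True] by simp
    qed simp
  qed
  moreover have "(\<integral>\<^sup>+z. \<infinity> * indicator (ball c e) z \<partial>lborel) = \<infinity>"
  proof -
    have "0 < e\<^sup>2 * pi" using \<open>0 < e\<close> by simp
    then have "emeasure lborel (ball c e) \<noteq> 0"
      using \<open>0 < e\<close> by (simp add: emeasure_ball unit_ball_vol_2 mult.commute)
    then show ?thesis by (subst nn_integral_cmult_indicator) (simp_all add: ennreal_top_mult)
  qed
  ultimately show ?thesis by (simp add: top_unique)
qed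

text \<open>
  The radius \<open>R\<close> lies between two consecutive radii of the sequence, by a factor of at least 2 away from
  both. There the function \<open>1/2 \<Sum>\<^sub>j\<^sub><\<^sub>k ln |1 - z / r (Suc j)| - ln |f z|\<close> differs from \<open>u_psi \<psi> z - ln |f z|\<close> by at most 1,
  and its circle mean is the function of \<open>s\<close> in the conclusion. The hypotheses \<open>mean\<close> are Jensen's formula
  for \<open>f\<close>; \<open>xs\<close> and \<open>C\<close> are parameters so that the same function of \<open>s\<close> serves for several \<open>R\<close>.
\<close>
lemma exists_radius_small_discrepancy:
  fixes \<psi> :: "real \<Rightarrow> real"
  assumes "\<psi> \<in> Phi" and double: "\<And>j. k < j \<Longrightarrow> 2 * rseq \<psi> j \<le> rseq \<psi> (Suc j)"
    and f: "f holomorphic_on UNIV"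
    and mean: "\<And>z. cmod z < rseq \<psi> (Suc k) \<Longrightarrow> (\<And>a. a \<in> set xs \<Longrightarrow> cmod a \<noteq> cmod z) \<Longrightarrow> f z \<noteq> 0"
      "\<And>z. cmod z < rseq \<psi> (Suc k) \<Longrightarrow> (\<And>a. a \<in> set xs \<Longrightarrow> cmod a \<noteq> cmod z) \<Longrightarrow>
       ((\<lambda>t. ln (cmod (f (z * cis (2 * pi * t))))) has_integral
         C + (\<Sum>a\<leftarrow>xs. ln (max (cmod z) (cmod a)))) {0..1}"
    and R: "2 * rseq \<psi> k \<le> R" "2 * R \<le> rseq \<psi> (Suc k)"
    and I: "error_integral \<psi> f R < ennreal (K * R\<^sup>2)" and "0 \<le> K"
  shows "\<exists>s. R / 2 < s \<and> s < R \<and>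
    \<bar>real k / 2 * ln s - (\<Sum>a\<leftarrow>xs. ln (max s (cmod a)))
      + (- 1 / 2 * (\<Sum>j<k. ln (rseq \<psi> (Suc j))) - C)\<bar> \<le> K + 3"
proof -
  define r where "r = rseq \<psi>"
  have r_pos: "0 < r j" for j using rseq_ge_2[OF \<open>\<psi> \<in> Phi\<close>, of j] by (simp add: r_def)
  have R_pos: "0 < R" using r_pos[of k] R by (simp add: r_def)
  define u0 where "u0 z = 1 / 2 * (\<Sum>j<k. ln (cmod (1 - z / of_real (r (Suc j)))))" for z
  define G where "G z = u0 z - ln (cmod (f z))" for z
  define A where "A = {z. R / 2 < cmod z \<and> cmod z < R}"
  define M where "M s = real k / 2 * ln s - (\<Sum>a\<leftarrow>xs. ln (max s (cmod a)))
      + (- 1 / 2 * (\<Sum>j<k. ln (r (Suc j))) - C)" for s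
  have [measurable]: "f \<in> borel_measurable borel"
    using f by (intro borel_measurable_continuous_onI holomorphic_on_imp_continuous_on)
  have [measurable]: "G \<in> borel_measurable borel" unfolding G_def u0_def by measurable
  have [measurable]: "(\<lambda>s. \<Sum>a\<leftarrow>xs. ln (max s (cmod a))) \<in> borel_measurable borel"
    by (induction xs) simp_all
  have [measurable]: "M \<in> borel_measurable borel" unfolding M_def by measurable
  have [measurable]: "A \<in> sets borel" unfolding A_def by measurable
  have r_less: "r (Suc j) < cmod z" if "z \<in> A" "j < k" for j z
  proof -
    have "r (Suc j) \<le> r k"
      unfolding r_def using incseq_rseq[OF \<open>\<psi> \<in> Phi\<close>] by (rule incseqD) (use \<open>j < k\<close> in simp)
    also have "\<dots> < cmod z" using R that by (simp add: A_def r_def)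
    finally show ?thesis .
  qed
  have less_r: "2 * cmod z < r (Suc k)" if "z \<in> A" for z
    using R that by (simp add: A_def r_def)

  have generic: "AE z in lborel. cmod z \<notin> cmod ` set xs"
    by (rule AE_cmod_notin_finite) simp
  have means: "continuous_on {0..1} (\<lambda>t. G (z * cis (2 * pi * t))) \<and>
      ((\<lambda>t. G (z * cis (2 * pi * t))) has_integral M (cmod z)) {0..1}"
    if z: "z \<in> A" "cmod z \<notin> cmod ` set xs" for z
  proof
    have zt: "z * cis t \<in> A" "cmod (z * cis t) \<notin> cmod ` set xs" for t
      using z by (simp_all add: A_def norm_mult)
    have ne: "1 - z * cis t / of_real (r (Suc j)) \<noteq> 0" if "j < k" for j t
    proof
      assume "1 - z * cis t / of_real (r (Suc j)) = 0"
      then have "z * cis t = of_real (r (Suc j))" using r_pos[of "Suc j"] by (auto simp: field_simps)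
      then have "cmod (z * cis t) = r (Suc j)" using r_pos[of "Suc j"] by simp
      then show False using r_less[OF z(1) that] by (simp add: norm_mult)
    qed
    have inside: "cmod z < rseq \<psi> (Suc k)"
      using less_r[OF z(1)] norm_ge_zero[of z] unfolding r_def by linarith
    have f_ne: "f (z * cis t) \<noteq> 0" for t
    proof (rule mean(1))
      show "cmod (z * cis t) < rseq \<psi> (Suc k)"
        using inside by (simp add: norm_mult del: rseq.simps)
    qed (use zt(2)[of t] in \<open>metis image_eqI\<close>)
    have [continuous_intros]: "continuous_on S (\<lambda>t. f (z * cis (2 * pi * t)))" for S
      by (rule continuous_on_compose2[OF holomorphic_on_imp_continuous_on[OF f]])
         (auto intro!: continuous_intros)
    show "continuous_on {0..1} (\<lambda>t. G (z * cis (2 * pi * t)))"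
      unfolding G_def u0_def using ne f_ne r_pos by (auto intro!: continuous_intros simp: less_imp_neq[THEN not_sym])
    have factor_mean: "((\<lambda>t. ln (cmod (1 - z * cis (2 * pi * t) / of_real (r (Suc j)))))
        has_integral (ln (cmod z) - ln (r (Suc j)))) {0..1}" if "j < k" for j
    proof -
      have "ln (cmod (z * cis t - of_real (r (Suc j)))) - ln (r (Suc j))
          = ln (cmod (1 - z * cis t / of_real (r (Suc j))))" for t
      proof -
        have "cmod (z * cis t - of_real (r (Suc j)))
            = cmod (of_real (r (Suc j)) * (1 - z * cis t / of_real (r (Suc j))))"
          using r_pos[of "Suc j"] by (simp add: right_diff_distrib norm_minus_commute)
        also have "\<dots> = r (Suc j) * cmod (1 - z * cis t / of_real (r (Suc j)))"
          using r_pos[of "Suc j"] by (simp add: norm_mult)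
        finally show ?thesis
          using r_pos[of "Suc j"] ne[OF that, of t] by (simp add: ln_mult)
      qed
      moreover have "((\<lambda>t. ln (cmod (z * cis (2 * pi * t) - of_real (r (Suc j)))) - ln (r (Suc j)))
          has_integral (ln (cmod z) - ln (r (Suc j)))) {0..1}"
        using has_integral_diff[OF ln_cmod_diff_circle_mean[of "of_real (r (Suc j))" z]
            has_integral_const_real[of "ln (r (Suc j))" 0 1]]
          r_less[OF z(1) that] r_pos[of "Suc j"] by (simp add: max_def)
      ultimately show ?thesis by simp
    qed
    have "((\<lambda>t. G (z * cis (2 * pi * t))) has_integral
        1 / 2 * (\<Sum>j<k. ln (cmod z) - ln (r (Suc j))) - (C + (\<Sum>a\<leftarrow>xs. ln (max (cmod z) (cmod a))))) {0..1}"
      unfolding G_def u0_def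
      by (intro has_integral_diff has_integral_mult_right has_integral_sum factor_mean mean(2))
         (use z(2) inside in \<open>auto simp: image_iff\<close>)
    also have "1 / 2 * (\<Sum>j<k. ln (cmod z) - ln (r (Suc j))) - (C + (\<Sum>a\<leftarrow>xs. ln (max (cmod z) (cmod a)))) = M (cmod z)"
      by (simp add: M_def sum_subtractf algebra_simps diff_divide_distrib)
    finally show "((\<lambda>t. G (z * cis (2 * pi * t))) has_integral M (cmod z)) {0..1}" .
  qed

  \<comment> \<open>The bound is put as a minorant \<open>\<bar>G z\<bar> - 1\<close> of the error, and not as a majorant of \<open>\<bar>G z\<bar>\<close>, because the
    minorant is Borel, so that the integral of \<open>(\<bar>G z\<bar> - 1) + 1\<close> may be split below. At negative values
    \<open>ennreal\<close> is 0.\<close>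
  have pointwise: "ennreal (\<bar>G z\<bar> - 1) \<le> e2ennreal \<bar>u_psi \<psi> z - log_abs (f z)\<bar>"
    if z: "z \<in> A" for z
  proof (cases "f z = 0")
    case True
    then have "\<bar>u_psi \<psi> z - log_abs (f z)\<bar> = \<infinity>" by (cases "u_psi \<psi> z") (auto simp: log_abs_def)
    then show ?thesis by simp
  next
    case False
    obtain T where T: "\<bar>T\<bar> \<le> 1" "u_psi \<psi> z = ereal (u0 z + T)"
    proof -
      have "z \<noteq> of_real (rseq \<psi> (Suc j))" if "j < k" for j
      proof
        assume "z = of_real (rseq \<psi> (Suc j))"
        then have "cmod z = r (Suc j)" using r_pos[of "Suc j"] by (simp add: r_def del: rseq.simps)
        with r_less[OF z that] show False by simp
      qed
      then show ?thesis
        using u_psi_expansion[of \<psi> k z] r_pos double less_r[OF z] that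
        unfolding u0_def r_def by metis
    qed
    have "\<bar>u_psi \<psi> z - log_abs (f z)\<bar> = ereal \<bar>G z + T\<bar>"
      using False by (simp add: T log_abs_def G_def algebra_simps)
    then show ?thesis using T(1) by (auto simp: e2ennreal_ereal intro!: ennreal_leI)
  qed
  have "(\<integral>\<^sup>+z\<in>A. ennreal \<bar>G z\<bar> \<partial>lborel)
      \<le> (\<integral>\<^sup>+z. ennreal (\<bar>G z\<bar> - 1) * indicator A z + indicator A z \<partial>lborel)"
  proof (rule nn_integral_mono)
    fix z
    have "ennreal \<bar>G z\<bar> \<le> ennreal (\<bar>G z\<bar> - 1) + 1"
      by (cases "\<bar>G z\<bar> \<le> 1") (auto simp flip: ennreal_1 ennreal_plus intro: order_trans ennreal_leI simp: ennreal_neg)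
    then show "ennreal \<bar>G z\<bar> * indicator A z \<le> ennreal (\<bar>G z\<bar> - 1) * indicator A z + indicator A z"
      by (auto simp: indicator_def)
  qed
  also have "\<dots> = (\<integral>\<^sup>+z\<in>A. ennreal (\<bar>G z\<bar> - 1) \<partial>lborel) + emeasure lborel A"
    by (simp add: nn_integral_add)
  also have "\<dots> \<le> error_integral \<psi> f R + ennreal (3 * R\<^sup>2)"
  proof (rule add_mono)
    show "(\<integral>\<^sup>+z\<in>A. ennreal (\<bar>G z\<bar> - 1) \<partial>lborel) \<le> error_integral \<psi> f R"
      using pointwise by (intro nn_integral_mono) (auto simp: indicator_def A_def)
    show "emeasure lborel A \<le> ennreal (3 * R\<^sup>2)"
      unfolding A_def emeasure_half_annulus[OF R_pos] using pi_less_4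
      by (intro ennreal_leI mult_right_mono) auto
  qed
  also have "\<dots> < ennreal (K * R\<^sup>2) + ennreal (3 * R\<^sup>2)"
    using I by (simp add: add.commute[of _ "ennreal (3 * R\<^sup>2)"] ennreal_add_left_cancel_less)
  also have "\<dots> = ennreal ((K + 3) * R\<^sup>2)"
    using \<open>0 \<le> K\<close> by (simp add: algebra_simps flip: ennreal_plus)
  finally have "(\<integral>\<^sup>+z\<in>A. ennreal \<bar>G z\<bar> \<partial>lborel) < ennreal ((K + 3) * R\<^sup>2)" .
  then have "\<exists>s. R / 2 < s \<and> s < R \<and> \<bar>M s\<bar> \<le> K + 3"
    using generic means R_pos \<open>0 \<le> K\<close>
    by (intro exists_radius_small_circle_mean[of G M]) (auto simp: A_def elim: eventually_mono)
  then show ?thesis unfolding M_def r_def .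
qed

text \<open>
  Values of \<open>\<psi>\<close> are compared only along the geometric progressions \<open>2 ^ j * r\<close>, where slow variation at the
  single ratio 2 can be iterated. Pointwise slow variation gives no uniformity in the ratio when \<open>\<psi>\<close> is not
  measurable.
\<close>
lemma doubling_bound:
  fixes \<psi> :: "real \<Rightarrow> real"
  assumes "\<And>R. R0 \<le> R \<Longrightarrow> \<psi> (2 * R) \<le> 2 * \<psi> R" "R0 \<le> r" "0 \<le> r"
  shows "\<psi> (2 ^ j * r) \<le> 2 ^ j * \<psi> r"
proof (induction j)
  case (Suc j)
  have "1 * r \<le> 2 ^ j * r" using \<open>0 \<le> r\<close> by (intro mult_right_mono) auto
  then have "\<psi> (2 * (2 ^ j * r)) \<le> 2 * \<psi> (2 ^ j * r)" using assms by auto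
  with Suc show ?case by (simp add: mult.assoc)
qed simp

lemma exists_power4_bracket:
  fixes p :: real
  assumes "2 \<le> p"
  shows "\<exists>m::nat. 2 * 4 ^ m \<le> p \<and> p < 8 * 4 ^ m"
proof -
  define n where "n = (LEAST n. p / 2 < 4 ^ n)"
  have "\<exists>n. p / 2 < 4 ^ n" using real_arch_pow[of 4 "p / 2"] by simp
  then have n: "p / 2 < 4 ^ n" unfolding n_def by (rule LeastI_ex)
  then obtain m where m: "n = Suc m" using assms by (cases n) auto
  then have "\<not> p / 2 < 4 ^ m" using not_less_Least[of m "\<lambda>n. p / 2 < 4 ^ n"] by (simp add: n_def)
  with n m show ?thesis by (intro exI[of _ m]) auto
qed

text \<open>
  Let \<open>r = rseq \<psi> k\<close> with \<open>k\<close> odd and large and \<open>p = \<psi> r\<close>, so that the annulus between this radius and the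
  next one has logarithmic width \<open>ln p\<close>. If the error integral were small, then \<open>|D|\<close> would be at most
  \<open>ln p / 16 + 3\<close> at points near the two ends and near the geometric middle of the annulus. These points are
  about \<open>ln p / 2\<close> apart on the logarithmic scale, whereas the parity argument forces two neighbours to be at most
  \<open>ln p / 4 + 12\<close> apart.
\<close>
lemma error_integral_not_small:
  assumes "\<psi> \<in> Phi" and top: "filterlim \<psi> at_top at_top"
    and rtop: "filterlim (rseq \<psi>) at_top sequentially"
    and f: "f holomorphic_on UNIV" "f z0 \<noteq> 0"
  shows "\<not> (\<forall>\<^sub>F R in at_top. error_integral \<psi> f R < ennreal (R\<^sup>2 * ln (\<psi> R) / 32))"
proof
  assume "\<forall>\<^sub>F R in at_top. error_integral \<psi> f R < ennreal (R\<^sup>2 * ln (\<psi> R) / 32)"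
  moreover have "\<forall>\<^sub>F R in at_top. \<psi> (2 * R) \<le> 2 * \<psi> R"
  proof -
    have "((\<lambda>R. \<psi> (2 * R) / \<psi> R) \<longlongrightarrow> 1) at_top"
      using \<open>\<psi> \<in> Phi\<close> by (auto simp: Phi_def slowly_varying_def)
    then have "\<forall>\<^sub>F R in at_top. \<psi> (2 * R) / \<psi> R < 2" by (rule order_tendstoD) simp
    with eventually_ge_at_top[of 1] show ?thesis
    proof eventually_elim
      case (elim R)
      then have "1 < \<psi> R" using \<open>\<psi> \<in> Phi\<close> by (auto simp: Phi_def)
      with elim show ?case by (simp add: pos_divide_less_eq)
    qed
  qed
  moreover have "\<forall>\<^sub>F R in at_top. 8 * 4 ^ 100 \<le> \<psi> R"
    using top by (simp add: filterlim_at_top)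
  ultimately have "\<forall>\<^sub>F R in at_top. error_integral \<psi> f R < ennreal (R\<^sup>2 * ln (\<psi> R) / 32) \<and>
      \<psi> (2 * R) \<le> 2 * \<psi> R \<and> 8 * 4 ^ 100 \<le> \<psi> R"
    by eventually_elim auto
  then obtain R0 where R0:
      "\<And>R. R0 \<le> R \<Longrightarrow> error_integral \<psi> f R < ennreal (R\<^sup>2 * ln (\<psi> R) / 32)"
      "\<And>R. R0 \<le> R \<Longrightarrow> \<psi> (2 * R) \<le> 2 * \<psi> R" "\<And>R. R0 \<le> R \<Longrightarrow> 8 * 4 ^ 100 \<le> \<psi> R"
    by (auto simp: eventually_at_top_linorder)
  have "\<forall>\<^sub>F k in sequentially. R0 \<le> rseq \<psi> k" using rtop by (simp add: filterlim_at_top)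
  then obtain N where N: "\<And>k. N \<le> k \<Longrightarrow> R0 \<le> rseq \<psi> k" by (auto simp: eventually_sequentially)
  \<comment> \<open>An odd index makes the mass \<open>k / 2\<close> of \<open>u_psi\<close> inside the annulus a half-integer.\<close>
  define k where "k = 2 * N + 1"
  define r where "r = rseq \<psi> k"
  define p where "p = \<psi> r"
  have "odd k" "N \<le> k" by (auto simp: k_def)
  have r: "R0 \<le> r" "2 \<le> r" using N[OF \<open>N \<le> k\<close>] rseq_ge_2[OF \<open>\<psi> \<in> Phi\<close>] by (auto simp: r_def)
  have p: "8 * 4 ^ 100 \<le> p" using R0(3)[OF r(1)] by (simp add: p_def)
  have double: "2 * rseq \<psi> j \<le> rseq \<psi> (Suc j)" if "k < j" for j
  proof -
    have "2 \<le> \<psi> (rseq \<psi> j)" using R0(3)[OF N[of j]] that \<open>N \<le> k\<close> by simp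
    then show ?thesis using rseq_ge_2[OF \<open>\<psi> \<in> Phi\<close>, of j] by simp
  qed
  \<comment> \<open>The three test radii are \<open>2 * r\<close>, \<open>2 ^ m * r\<close> and \<open>4 ^ m * r\<close>; the factor 2 in \<open>2 * 4 ^ m \<le> p\<close> keeps the last one
    below half of the next radius \<open>r * p\<close>.\<close>
  obtain m where m: "2 * 4 ^ m \<le> p" "p < 8 * 4 ^ m"
    using exists_power4_bracket[of p] p by auto
  have "100 < m"
  proof -
    have "(4 :: real) ^ 100 < 4 ^ m" using p m by linarith
    then show ?thesis by (rule power_less_imp_less_exp[rotated]) simp
  qed
  have ln_p: "ln p < (2 * real m + 3) * ln 2" "0 < ln p"
  proof -
    have "(8::real) * 4 ^ m = 2 ^ (2 * m + 3)" by (simp add: power_add power_mult)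
    then have "p < 2 ^ (2 * m + 3)" using m by simp
    then have "ln p < ln (2 ^ (2 * m + 3))" using p by (subst ln_less_cancel_iff) auto
    then show "ln p < (2 * real m + 3) * ln 2" by (simp add: ln_realpow del: power_Suc)
    show "0 < ln p" using p by simp
  qed
  obtain xs C where mean:
      "\<And>z. cmod z < rseq \<psi> (Suc k) \<Longrightarrow> (\<And>a. a \<in> set xs \<Longrightarrow> cmod a \<noteq> cmod z) \<Longrightarrow> f z \<noteq> 0"
      "\<And>z. cmod z < rseq \<psi> (Suc k) \<Longrightarrow> (\<And>a. a \<in> set xs \<Longrightarrow> cmod a \<noteq> cmod z) \<Longrightarrow>
       ((\<lambda>t. ln (cmod (f (z * cis (2 * pi * t))))) has_integral
         C + (\<Sum>a\<leftarrow>xs. ln (max (cmod z) (cmod a)))) {0..1}"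
    using entire_circle_mean[OF f] by metis
  define D where "D s = real k / 2 * ln s - (\<Sum>a\<leftarrow>xs. ln (max s (cmod a)))
      + (- 1 / 2 * (\<Sum>j<k. ln (rseq \<psi> (Suc j))) - C)" for s
  define K where "K = ln p / 16 + 3"
  have radius: "\<exists>s. 2 ^ j * r < s \<and> s < 2 * (2 ^ j * r) \<and> \<bar>D s\<bar> \<le> K" if j: "j < 2 * m" for j
  proof -
    define R where "R = 2 ^ Suc j * r"
    have "(2::real) ^ Suc j \<le> 2 ^ (2 * m)" using j by (intro power_increasing) auto
    then have pow: "2 * 2 ^ Suc j \<le> p" using m by (simp add: power_mult)
    have "1 * r \<le> 2 ^ j * r" using r by (intro mult_right_mono) auto
    then have R: "2 * r \<le> R" by (simp add: R_def)
    have R': "2 * R \<le> r * p"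
      using mult_left_mono[OF pow, of r] r by (simp add: R_def mult_ac)
    \<comment> \<open>Doubling costs at most a factor \<open>2 ^ Suc j \<le> p\<close>, so \<open>ln (\<psi> R)\<close> and \<open>ln p\<close> are comparable.\<close>
    have "\<psi> R \<le> 2 ^ Suc j * p"
      unfolding R_def p_def using doubling_bound[of R0 \<psi> r "Suc j"] R0(2) r by simp
    also have "\<dots> \<le> p * p" using pow p by (intro mult_right_mono) auto
    finally have "\<psi> R \<le> p * p" .
    moreover have "8 * 4 ^ 100 \<le> \<psi> R" using R r by (intro R0(3)) simp
    ultimately have "ln (\<psi> R) \<le> ln (p * p)" by (intro ln_mono) auto
    also have "\<dots> = 2 * ln p" using p by (subst ln_mult) auto
    finally have le: "R\<^sup>2 * ln (\<psi> R) / 32 \<le> ln p / 16 * R\<^sup>2"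
      using mult_left_mono[of "ln (\<psi> R)" "2 * ln p" "R\<^sup>2"] by (simp add: mult_ac)
    have I: "error_integral \<psi> f R < ennreal (ln p / 16 * R\<^sup>2)"
      by (rule less_le_trans[OF R0(1) ennreal_leI[OF le]]) (use R r in simp)
    have "\<exists>s. R / 2 < s \<and> s < R \<and> \<bar>D s\<bar> \<le> K"
      unfolding D_def K_def
      by (rule exists_radius_small_discrepancy[OF \<open>\<psi> \<in> Phi\<close> double f(1) mean])
         (use R R' I ln_p in \<open>simp_all add: r_def[symmetric] p_def[symmetric]\<close>)
    then show ?thesis by (simp add: R_def mult.assoc)
  qed
  have idx: "m - 1 < 2 * m" "2 * m - 1 < 2 * m" using \<open>100 < m\<close> by auto
  obtain s1 where s1: "r < s1" "s1 < 2 * r" "\<bar>D s1\<bar> \<le> K"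
    using radius[of 0] \<open>100 < m\<close> by auto
  obtain s2 where s2: "2 ^ (m - 1) * r < s2" "s2 < 2 * (2 ^ (m - 1) * r)" "\<bar>D s2\<bar> \<le> K"
    using radius[of "m - 1"] idx by blast
  obtain s3 where s3: "2 ^ (2 * m - 1) * r < s3" "\<bar>D s3\<bar> \<le> K"
    using radius[of "2 * m - 1"] idx by blast
  have ln_pow: "ln (2 ^ n * r) = real n * ln 2 + ln r" for n
    using r by (simp add: ln_mult ln_realpow)
  \<comment> \<open>In these units \<open>ln s1\<close>, \<open>ln s2\<close>, \<open>ln s3\<close> exceed \<open>ln r\<close> by about \<open>0\<close>, \<open>q\<close> and \<open>2 * q\<close>, and \<open>ln p\<close> is about \<open>2 * q\<close>.\<close>
  define l q where "l = ln (2 :: real)" and "q = real m * l"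
  have l: "2 / 3 \<le> l" unfolding l_def by (rule ln2_ge_two_thirds)
  have q: "100 * l \<le> q" using \<open>100 < m\<close> l unfolding q_def by (intro mult_right_mono) auto
  have pos: "0 < 2 ^ n * r" for n :: nat using r by simp
  have "0 < s1" "0 < s2" "0 < s3" using s1(1) s2(1) s3(1) r pos[of "m - 1"] pos[of "2 * m - 1"] by linarith+
  have ln1: "ln s1 < l + ln r"
    using s1 r \<open>0 < s1\<close> ln_pow[of 1] ln_less_cancel_iff[of s1 "2 ^ 1 * r"] by (simp add: l_def)
  have ln2: "q - l + ln r < ln s2" "ln s2 < q + ln r"
  proof -
    have "ln (2 ^ (m - 1) * r) < ln s2" using s2 pos[of "m - 1"] \<open>0 < s2\<close> by (subst ln_less_cancel_iff) auto
    then show "q - l + ln r < ln s2"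
      using \<open>100 < m\<close> unfolding ln_pow by (simp add: of_nat_diff q_def l_def left_diff_distrib)
    have "2 * (2 ^ (m - 1) * r) = 2 ^ m * r" using \<open>100 < m\<close> by (cases m) auto
    then have "s2 < 2 ^ m * r" using s2(2) by (simp only:)
    then have "ln s2 < ln (2 ^ m * r)" using \<open>0 < s2\<close> by simp
    then show "ln s2 < q + ln r" unfolding ln_pow by (simp add: q_def l_def)
  qed
  have ln3: "2 * q - l + ln r < ln s3"
  proof -
    have "ln (2 ^ (2 * m - 1) * r) < ln s3"
      using s3 pos[of "2 * m - 1"] \<open>0 < s3\<close> by (subst ln_less_cancel_iff) auto
    then show ?thesis
      using \<open>100 < m\<close> unfolding ln_pow by (simp add: of_nat_diff q_def l_def left_diff_distrib)
  qed
  have "ln p < 2 * q + 3 * l" using ln_p by (simp add: q_def l_def distrib_right)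
  then have gap: "4 * K < q - 2 * l" using l q by (simp add: K_def field_simps)
  have "ln s1 \<le> ln s2" "ln s2 \<le> ln s3" using ln1 ln2 ln3 l q by linarith+
  then have "s1 \<le> s2" "s2 \<le> s3" using \<open>0 < s1\<close> \<open>0 < s2\<close> \<open>0 < s3\<close> by simp_all
  then have "ln s2 - ln s1 \<le> 4 * K \<or> ln s3 - ln s2 \<le> 4 * K"
    using s1(3) s2(3) s3(2) \<open>0 < s1\<close> \<open>odd k\<close> unfolding D_def by (intro odd_slope_gap)
  with gap ln1 ln2 ln3 l show False by linarith
qed

lemma less_of_ennreal_divide_less:
  assumes "x / ennreal c < ennreal e" "0 < c" "0 < e"
  shows "x < ennreal (c * e)"
proof (cases x)
  case (real y)
  with assms show ?thesis by (simp add: divide_ennreal ennreal_less_iff field_simps)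
next
  case top
  with assms show ?thesis by (simp add: ennreal_top_divide)
qed

theorem theorem2:
  fixes \<psi> :: "real \<Rightarrow> real"
  assumes "\<psi> \<in> Phi"
    and "filterlim \<psi> at_top at_top"
  shows "\<not> (\<exists>f :: complex \<Rightarrow> complex. f holomorphic_on UNIV \<and>
           ((\<lambda>R :: real. (\<integral>\<^sup>+ z \<in> {z. cmod z < R}. e2ennreal \<bar>u_psi \<psi> z - log_abs (f z)\<bar> \<partial>lborel)
                 / ennreal (R\<^sup>2 * ln (\<psi> R))) \<longlongrightarrow> 0) at_top)"
proof
  assume "\<exists>f :: complex \<Rightarrow> complex. f holomorphic_on UNIV \<and>
    ((\<lambda>R :: real. error_integral \<psi> f R / ennreal (R\<^sup>2 * ln (\<psi> R))) \<longlongrightarrow> 0) at_top"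
  then obtain f :: "complex \<Rightarrow> complex" where f: "f holomorphic_on UNIV"
    and lim: "((\<lambda>R :: real. error_integral \<psi> f R / ennreal (R\<^sup>2 * ln (\<psi> R))) \<longlongrightarrow> 0) at_top"
    by blast
  have "\<forall>\<^sub>F R in at_top. error_integral \<psi> f R / ennreal (R\<^sup>2 * ln (\<psi> R)) < ennreal (1 / 32)"
    by (rule order_tendstoD(2)[OF lim]) simp
  with eventually_ge_at_top[of 1]
  have small: "\<forall>\<^sub>F R in at_top. error_integral \<psi> f R < ennreal (R\<^sup>2 * ln (\<psi> R) / 32)"
  proof eventually_elim
    case (elim R)
    have "1 < \<psi> R" using \<open>\<psi> \<in> Phi\<close> elim(1) by (auto simp: Phi_def)
    then show ?case using less_of_ennreal_divide_less[OF elim(2)] elim(1) by simp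
  qed
  \<comment> \<open>Both degenerate cases, \<open>f = 0\<close> and bounded radii, make the integrand infinite on a ball.\<close>
  have not_infinite: "\<exists>z\<in>ball c e. \<bar>u_psi \<psi> z - log_abs (f z)\<bar> \<noteq> \<infinity>" if "0 < e" for c e
  proof (rule ccontr)
    assume "\<not> ?thesis"
    then have inf: "error_integral \<psi> f R = \<infinity>" if "cmod c + e \<le> R" for R
      using error_integral_eq_infinity[OF \<open>0 < e\<close> that] by blast
    have "\<forall>\<^sub>F R::real in at_top. False"
      using small eventually_ge_at_top[of "cmod c + e"] by eventually_elim (simp add: inf)
    then show False by simp
  qed
  have f_ne: "f z \<noteq> 0" if "\<bar>u_psi \<psi> z - log_abs (f z)\<bar> \<noteq> \<infinity>" for z
    using that by (cases "u_psi \<psi> z") (auto simp: log_abs_def)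
  obtain z0 where z0: "f z0 \<noteq> 0"
    using not_infinite[OF zero_less_one, of 0] by (elim bexE) (rule that, rule f_ne)
  show False
  proof (cases "Bseq (rseq \<psi>)")
    case True
    then obtain L where L: "rseq \<psi> \<longlonglongrightarrow> L"
      using Bseq_mono_convergent incseq_rseq[OF \<open>\<psi> \<in> Phi\<close>] by (metis convergentD incseqD monoseq_def Bseq_monoseq_convergent)
    have "2 \<le> L" using rseq_ge_2[OF \<open>\<psi> \<in> Phi\<close>] by (intro LIMSEQ_le_const[OF L]) auto
    \<comment> \<open>A ball around \<open>c\<close> that avoids the real axis and lies in the disc \<open>|1 - z / L| < 1\<close>.\<close>
    define c where "c = of_real (L / 2) * (1 + \<i> / 2)"
    have "\<bar>u_psi \<psi> z - log_abs (f z)\<bar> = \<infinity>" if z: "z \<in> ball c (L / 8)" for z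
    proof -
      have d: "cmod (z - c) < L / 8" using z by (simp add: dist_norm norm_minus_commute)
      have "L / 4 - Im z < L / 8" using d abs_Im_le_cmod[of "z - c"] by (simp add: c_def)
      then have "Im z \<noteq> 0" using \<open>2 \<le> L\<close> by auto
      have "cmod (of_real L - c) \<le> 3 / 4 * L"
      proof -
        have "of_real L - c = of_real (L / 2) * (1 - \<i> / 2)" by (simp add: c_def algebra_simps)
        then have "cmod (of_real L - c) = \<bar>L / 2\<bar> * cmod (1 - \<i> / 2)"
          by (simp only: norm_mult norm_of_real)
        also have "\<dots> \<le> \<bar>L / 2\<bar> * (1 + 1 / 2)"
          using norm_triangle_ineq4[of 1 "\<i> / 2"] by (intro mult_left_mono) (simp_all add: norm_divide)
        finally show ?thesis using \<open>2 \<le> L\<close> by simp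
      qed
      then have "cmod (of_real L - z) < L"
        using d norm_triangle_ineq4[of "of_real L - c" "z - c"] \<open>2 \<le> L\<close> by simp
      moreover have "1 - z / of_real L = (of_real L - z) / of_real L" using \<open>2 \<le> L\<close> by (simp add: field_simps)
      ultimately have "cmod (1 - z / of_real L) < 1" using \<open>2 \<le> L\<close> by (simp add: norm_divide)
      then have "u_psi \<psi> z = - \<infinity>"
        using L \<open>Im z \<noteq> 0\<close> \<open>2 \<le> L\<close> by (intro u_psi_eq_minus_infinity) auto
      then show ?thesis by (simp add: log_abs_def)
    qed
    then show False using not_infinite[of "L / 8" c] \<open>2 \<le> L\<close> by auto
  next
    case False
    have "filterlim (rseq \<psi>) at_top sequentially"
      unfolding filterlim_at_top
    proof
      fix B
      have "\<exists>N. B < rseq \<psi> N"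
      proof (rule ccontr)
        assume "\<not> ?thesis"
        then have "norm (rseq \<psi> n) \<le> B" for n
          using rseq_ge_2[OF \<open>\<psi> \<in> Phi\<close>, of n] by (simp add: not_less)
        then show False using False by (blast intro: BseqI')
      qed
      then show "\<forall>\<^sub>F n in sequentially. B \<le> rseq \<psi> n"
        using incseqD[OF incseq_rseq[OF \<open>\<psi> \<in> Phi\<close>]] unfolding eventually_sequentially
        by (meson less_imp_le order_trans)
    qed
    then show False using error_integral_not_small[OF assms _ f z0] small by blast
  qed
qed

end
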